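(* Let $1<p<2$ and let $\{\varepsilon_k:k\in\mathbb Z\}$ be independent and identically distributed real random variables such that $x^p\Pr\{|\varepsilon_0|>x\}\to0$ as $x\to\infty$ and $\operatorname E\varepsilon_0=0$. Let $\{\psi_j:j\in\mathbb Z\}\subset\mathbb R$ with $\psi_j=0$ for $j<0$. If $\sum_{j=0}^\infty|\psi_j|<\infty$, then $$\frac{S_n}{n^{1/p}}\to0\quad\text{in probability as } n\to\infty.$$
   Context: The linear process $\{X_k:k\in\mathbb Z\}$ is defined by the almost surely convergent series $X_k=\sum_{j=0}^\infty\psi_j\varepsilon_{k-j}$, and $S_n=\sum_{k=1}^nX_k$ for $n\ge1$. *)

theory Defs
  imports "HOL-Probability.Probability"
begin

(* The coefficient sequence is indexed by the integers; only its values at j >= 0 enter.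
   Where the series diverges, suminf has an unspecified value; by linear_process_AE_sums
   this happens only on a null set. *)
definition linear_process :: "(int \<Rightarrow> real) \<Rightarrow> (int \<Rightarrow> 'a \<Rightarrow> real) \<Rightarrow> int \<Rightarrow> 'a \<Rightarrow> real" where
  "linear_process \<psi> \<epsilon> k \<omega> = (\<Sum>j::nat. \<psi> (int j) * \<epsilon> (k - int j) \<omega>)"

definition linear_process_sum :: "(int \<Rightarrow> real) \<Rightarrow> (int \<Rightarrow> 'a \<Rightarrow> real) \<Rightarrow> nat \<Rightarrow> 'a \<Rightarrow> real" where
  "linear_process_sum \<psi> \<epsilon> n \<omega> = (\<Sum>k=1..n. linear_process \<psi> \<epsilon> (int k) \<omega>)"

(* Measurability is part of the definition because the measure of a non-measurable set is 0
   by convention. *)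
definition tendsto_in_probability ::
    "'a measure \<Rightarrow> (nat \<Rightarrow> 'a \<Rightarrow> real) \<Rightarrow> ('a \<Rightarrow> real) \<Rightarrow> bool" where
  "tendsto_in_probability M Y Z \<longleftrightarrow>
     (\<forall>n. Y n \<in> borel_measurable M) \<and> Z \<in> borel_measurable M \<and>
     (\<forall>\<delta>>0. (\<lambda>n. measure M {\<omega> \<in> space M. \<bar>Y n \<omega> - Z \<omega>\<bar> > \<delta>}) \<longlonglongrightarrow> 0)"

lemma linear_process_measurable:
  assumes "\<And>k. \<epsilon> k \<in> borel_measurable M"
  shows "linear_process \<psi> \<epsilon> k \<in> borel_measurable M"
proof -
  note [measurable] = assms
  show ?thesis
    unfolding linear_process_def[abs_def] by measurable
qed

lemma linear_process_AE_sums: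
  fixes M :: "'a measure" and \<epsilon> :: "int \<Rightarrow> 'a \<Rightarrow> real" and \<psi> :: "int \<Rightarrow> real"
  assumes meas: "\<And>k. \<epsilon> k \<in> borel_measurable M"
    and ident: "\<And>k. distr M borel (\<epsilon> k) = distr M borel (\<epsilon> 0)"
    and int: "integrable M (\<epsilon> 0)"
    and psi: "summable (\<lambda>j::nat. \<bar>\<psi> (int j)\<bar>)"
  shows "AE \<omega> in M. (\<lambda>j::nat. \<psi> (int j) * \<epsilon> (k - int j) \<omega>) sums linear_process \<psi> \<epsilon> k \<omega>"
proof -
  note [measurable] = meas
  define C where "C = (\<integral>\<^sup>+\<omega>. ennreal \<bar>\<epsilon> 0 \<omega>\<bar> \<partial>M)"
  have C: "C < \<infinity>"
    using int by (simp add: C_def integrable_iff_bounded)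
  have nn: "(\<integral>\<^sup>+\<omega>. ennreal \<bar>\<epsilon> i \<omega>\<bar> \<partial>M) = C" for i
  proof -
    have "(\<integral>\<^sup>+\<omega>. ennreal \<bar>\<epsilon> i \<omega>\<bar> \<partial>M) = (\<integral>\<^sup>+x. ennreal \<bar>x\<bar> \<partial>distr M borel (\<epsilon> i))"
      by (subst nn_integral_distr) auto
    also have "\<dots> = C"
      unfolding C_def by (subst ident, subst nn_integral_distr) auto
    finally show ?thesis .
  qed
  have "(\<integral>\<^sup>+\<omega>. (\<Sum>j. ennreal \<bar>\<psi> (int j) * \<epsilon> (k - int j) \<omega>\<bar>) \<partial>M)
      = (\<Sum>j. \<integral>\<^sup>+\<omega>. ennreal \<bar>\<psi> (int j) * \<epsilon> (k - int j) \<omega>\<bar> \<partial>M)"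
    by (rule nn_integral_suminf) measurable
  also have "\<dots> = (\<Sum>j. ennreal \<bar>\<psi> (int j)\<bar> * C)"
    by (simp add: abs_mult ennreal_mult nn_integral_cmult nn)
  also have "\<dots> = (\<Sum>j. ennreal \<bar>\<psi> (int j)\<bar>) * C"
    by simp
  also have "\<dots> = ennreal (\<Sum>j. \<bar>\<psi> (int j)\<bar>) * C"
    using psi by (subst suminf_ennreal2) auto
  also have "\<dots> < \<infinity>"
    using C by (simp add: ennreal_mult_less_top)
  finally have "AE \<omega> in M. (\<Sum>j. ennreal \<bar>\<psi> (int j) * \<epsilon> (k - int j) \<omega>\<bar>) \<noteq> \<infinity>"
    by (intro nn_integral_PInf_AE borel_measurable_suminf_order) auto
  then show ?thesis
  proof eventually_elim
    case (elim \<omega>)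
    then have "summable (\<lambda>j. \<bar>\<psi> (int j) * \<epsilon> (k - int j) \<omega>\<bar>)"
      by (intro summable_suminf_not_top) auto
    then have "summable (\<lambda>j. \<psi> (int j) * \<epsilon> (k - int j) \<omega>)"
      by (rule summable_rabs_cancel)
    then show ?case
      unfolding linear_process_def by (rule summable_sums)
  qed
qed

end

theory Submission
  imports Defs
begin

text \<open>
  The normalized partial sums converge to 0 even in \<open>L\<^sup>1\<close>, and Markov's inequality turns this into
  convergence in probability. Working in \<open>L\<^sup>1\<close> removes the dependence inside the linear process:
  since \<open>S\<^sub>n = \<Sum>\<^sub>j \<psi>\<^sub>j W\<^sub>n\<^sub>,\<^sub>j\<close> with \<open>W\<^sub>n\<^sub>,\<^sub>j\<close> the sum of the \<open>n\<close> consecutive innovations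
  \<open>\<epsilon>\<^sub>1\<^sub>-\<^sub>j, \<dots>, \<epsilon>\<^sub>n\<^sub>-\<^sub>j\<close>, the triangle inequality gives
  \<open>E|S\<^sub>n| \<le> (\<Sum>\<^sub>j |\<psi>\<^sub>j|) sup\<^sub>j E|W\<^sub>n\<^sub>,\<^sub>j|\<close> (\<open>nn_integral_linear_process_sum_le\<close>). Absolute summability
  of the coefficients therefore reduces the claim to \<open>E|W\<^sub>n\<^sub>,\<^sub>j| = o(n\<^sup>1\<^sup>/\<^sup>p)\<close> uniformly in \<open>j\<close>, a
  statement about sums of \<open>n\<close> independent, identically distributed, centred variables.

  For these the innovations are truncated at a level \<open>a\<close>. With \<open>V(a)\<close> the second moment of the
  truncated innovation and \<open>T(a)\<close> the first absolute moment of what is cut off, an \<open>L\<^sup>2\<close> bound on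
  the one part and an \<open>L\<^sup>1\<close> bound on the other yield \<open>E|W\<^sub>n\<^sub>,\<^sub>j| \<le> sqrt (n V(a)) + 2 n T(a)\<close>
  (\<open>expectation_abs_sum_iid_le\<close>). Integrating the tail \<open>P(|\<epsilon>\<^sub>0| > x) = o(x\<^sup>-\<^sup>p)\<close> shows
  \<open>V(a) = o(a\<^sup>2\<^sup>-\<^sup>p)\<close>, because \<open>p < 2\<close>, and \<open>T(a) = o(a\<^sup>1\<^sup>-\<^sup>p)\<close>, because \<open>p > 1\<close>
  (\<open>truncated_second_moment_tendsto_0\<close>, \<open>truncation_error_tendsto_0\<close>). At the level
  \<open>a = n\<^sup>1\<^sup>/\<^sup>p\<close>, where \<open>n = a\<^sup>p\<close>, both terms are \<open>o(a)\<close>.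
\<close>

section \<open>Truncated moments and tail probabilities\<close>

definition truncate_at :: "real \<Rightarrow> real \<Rightarrow> real" where
  "truncate_at a x = (if \<bar>x\<bar> \<le> a then x else 0)"

lemma truncate_at_measurable [measurable]: "truncate_at a \<in> borel_measurable borel"
  unfolding truncate_at_def[abs_def] by measurable

lemma abs_truncate_at_le: "\<bar>truncate_at a x\<bar> \<le> \<bar>x\<bar>"
  and abs_minus_truncate_at_le: "\<bar>x - truncate_at a x\<bar> \<le> \<bar>x\<bar>"
  by (auto simp: truncate_at_def)

lemma (in prob_space) integrable_truncate_at_square:
  fixes X :: "'a \<Rightarrow> real"
  assumes "X \<in> borel_measurable M" and "0 \<le> a"
  shows "integrable M (\<lambda>\<omega>. (truncate_at a (X \<omega>))\<^sup>2)"
  using assms by (intro integrable_const_bound[where B = "a\<^sup>2"])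
    (auto simp: truncate_at_def abs_le_square_iff[symmetric])

text \<open>
  Tonelli's theorem on the region below the graph of \<open>X\<close>. If \<open>w\<close> is nonnegative with primitive \<open>F\<close> and
  vanishes on the negative half-line, the inner integral on the left is \<open>F (X \<omega>) - F 0\<close> for
  \<open>X \<omega> \<ge> 0\<close>, so the lemma turns moments of \<open>X\<close> into integrals of its tail probabilities. Here
  \<open>w\<close> is \<open>2 x\<close> cut off outside \<open>[0, a]\<close> for the truncated second moment, and the indicator of
  \<open>[a, \<infinity>)\<close> for the truncation error.
\<close>

lemma (in prob_space) nn_integral_layer_cake:
  fixes X :: "'a \<Rightarrow> real" and w :: "real \<Rightarrow> ennreal"
  assumes [measurable]: "X \<in> borel_measurable M" "w \<in> borel_measurable borel"
  shows "(\<integral>\<^sup>+\<omega>. (\<integral>\<^sup>+x. w x * indicator {..<X \<omega>} x \<partial>lborel) \<partial>M)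
       = (\<integral>\<^sup>+x. w x * emeasure M {\<omega> \<in> space M. x < X \<omega>} \<partial>lborel)"
proof -
  interpret P: pair_sigma_finite M lborel ..
  have "(\<integral>\<^sup>+\<omega>. (\<integral>\<^sup>+x. w x * indicator {..<X \<omega>} x \<partial>lborel) \<partial>M)
      = (\<integral>\<^sup>+\<omega>. (\<integral>\<^sup>+x. w x * of_bool (x < X \<omega>) \<partial>lborel) \<partial>M)"
    by (intro nn_integral_cong) (simp add: indicator_def)
  also have "\<dots> = (\<integral>\<^sup>+x. (\<integral>\<^sup>+\<omega>. w x * of_bool (x < X \<omega>) \<partial>M) \<partial>lborel)"
    by (rule P.Fubini'[symmetric]) measurable
  also have "\<dots> = (\<integral>\<^sup>+x. (\<integral>\<^sup>+\<omega>. w x * indicator {\<omega> \<in> space M. x < X \<omega>} \<omega> \<partial>M) \<partial>lborel)"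
    by (intro nn_integral_cong) (simp add: indicator_def)
  also have "\<dots> = (\<integral>\<^sup>+x. w x * emeasure M {\<omega> \<in> space M. x < X \<omega>} \<partial>lborel)"
    by (intro nn_integral_cong nn_integral_cmult_indicator) measurable
  finally show ?thesis .
qed

text \<open>
  The truncated second moment is at most \<open>\<integral>\<^sub>0\<^sup>a 2 x P(|X| > x) dx\<close>. Below \<open>K\<close> the probability is
  bounded by 1; above \<open>K\<close> it is bounded by \<open>\<eta> x\<^sup>-\<^sup>p\<close>, and \<open>x\<^sup>1\<^sup>-\<^sup>p\<close> has the primitive
  \<open>x\<^sup>2\<^sup>-\<^sup>p / (2 - p)\<close>, which is nonnegative because \<open>p < 2\<close>, so its
  value at \<open>K\<close> can be dropped. The term \<open>K\<^sup>2\<close> does not grow with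
  \<open>a\<close>, so the small constant \<open>\<eta>\<close> governs the order of growth.
\<close>

lemma (in prob_space) truncated_second_moment_le:
  fixes X :: "'a \<Rightarrow> real"
  assumes [measurable]: "X \<in> borel_measurable M"
    and p: "0 < p" "p < 2" and K: "0 < K" "K \<le> a" and "0 \<le> \<eta>"
    and tail: "\<And>x. K \<le> x \<Longrightarrow> x powr p * prob {\<omega> \<in> space M. \<bar>X \<omega>\<bar> > x} \<le> \<eta>"
  shows "expectation (\<lambda>\<omega>. (truncate_at a (X \<omega>))\<^sup>2) \<le> K\<^sup>2 + 2 * \<eta> / (2 - p) * a powr (2 - p)"
proof -
  let ?w = "\<lambda>x::real. ennreal (2 * x) * indicator {0..a} x"
  let ?v = "\<lambda>x::real. ennreal (2 * \<eta> * x powr (1 - p)) * indicator {K..a} x"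
  have square: "(\<integral>\<^sup>+x. ennreal (2 * x) * indicator {0..b} x \<partial>lborel) = ennreal (b\<^sup>2)"
    if "0 \<le> b" for b :: real
  proof -
    have "(\<integral>\<^sup>+x. ennreal (2 * x) * indicator {0..b} x \<partial>lborel) = ennreal (b\<^sup>2 - 0\<^sup>2)"
      using that by (intro nn_integral_FTC_Icc) (auto intro!: derivative_eq_intros)
    then show ?thesis by simp
  qed
  have "ennreal (expectation (\<lambda>\<omega>. (truncate_at a (X \<omega>))\<^sup>2))
      = (\<integral>\<^sup>+\<omega>. ennreal ((truncate_at a (X \<omega>))\<^sup>2) \<partial>M)"
    using K by (intro nn_integral_eq_integral[symmetric] integrable_truncate_at_square) auto
  also have "\<dots> \<le> (\<integral>\<^sup>+\<omega>. (\<integral>\<^sup>+x. ?w x * indicator {..<\<bar>X \<omega>\<bar>} x \<partial>lborel) \<partial>M)"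
  proof (rule nn_integral_mono)
    fix \<omega>
    show "ennreal ((truncate_at a (X \<omega>))\<^sup>2) \<le> (\<integral>\<^sup>+x. ?w x * indicator {..<\<bar>X \<omega>\<bar>} x \<partial>lborel)"
    proof (cases "\<bar>X \<omega>\<bar> \<le> a")
      case True
      have "ennreal ((truncate_at a (X \<omega>))\<^sup>2)
          = (\<integral>\<^sup>+x. ennreal (2 * x) * indicator {0..\<bar>X \<omega>\<bar>} x \<partial>lborel)"
        using True by (simp add: square truncate_at_def)
      also have "\<dots> \<le> (\<integral>\<^sup>+x. ?w x * indicator {..<\<bar>X \<omega>\<bar>} x \<partial>lborel)"
      \<comment> \<open>The two intervals differ only in the end point \<open>|X \<omega>|\<close>, a null set.\<close>
      proof (rule nn_integral_mono_AE)
        show "AE x in lborel. ennreal (2 * x) * indicator {0..\<bar>X \<omega>\<bar>} x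
            \<le> ?w x * indicator {..<\<bar>X \<omega>\<bar>} x"
          using AE_lborel_singleton[of "\<bar>X \<omega>\<bar>"]
          by eventually_elim (use True in \<open>simp add: indicator_def\<close>)
      qed
      finally show ?thesis .
    qed (simp add: truncate_at_def)
  qed
  also have "\<dots> = (\<integral>\<^sup>+x. ?w x * emeasure M {\<omega> \<in> space M. x < \<bar>X \<omega>\<bar>} \<partial>lborel)"
    by (rule nn_integral_layer_cake) auto
  also have "\<dots> \<le> (\<integral>\<^sup>+x. ennreal (2 * x) * indicator {0..K} x + ?v x \<partial>lborel)"
  proof (rule nn_integral_mono)
    fix x :: real
    let ?G = "prob {\<omega> \<in> space M. x < \<bar>X \<omega>\<bar>}"
    show "?w x * emeasure M {\<omega> \<in> space M. x < \<bar>X \<omega>\<bar>} \<le> ennreal (2 * x) * indicator {0..K} x + ?v x"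
    proof (cases "K < x \<and> x \<le> a")
      case True
      have "2 * x * ?G = 2 * x powr (1 - p) * (x powr p * ?G)"
        using True K by (simp add: powr_diff field_simps)
      also have "\<dots> \<le> 2 * x powr (1 - p) * \<eta>"
        using tail[of x] True by (intro mult_left_mono) auto
      finally have "2 * x * ?G \<le> 2 * \<eta> * x powr (1 - p)"
        by (simp add: mult_ac)
      then show ?thesis
        using True K by (simp add: emeasure_eq_measure ennreal_mult'[symmetric] ennreal_leI)
    next
      case False
      show ?thesis
      proof (cases "0 \<le> x \<and> x \<le> K")
        case True
        have "ennreal (2 * x) * emeasure M {\<omega> \<in> space M. x < \<bar>X \<omega>\<bar>} \<le> ennreal (2 * x) * 1"
          by (intro mult_left_mono measure_le_1) auto
        then show ?thesis
          using True K by (auto simp: add_increasing2)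
      next
        case out: False
        then show ?thesis using False by (auto simp: indicator_def)
      qed
    qed
  qed
  also have "\<dots> = ennreal (K\<^sup>2) + (\<integral>\<^sup>+x. ?v x \<partial>lborel)"
    using K by (subst nn_integral_add) (auto simp: square)
  also have "(\<integral>\<^sup>+x. ?v x \<partial>lborel)
      = ennreal (2 * \<eta> / (2 - p) * a powr (2 - p) - 2 * \<eta> / (2 - p) * K powr (2 - p))"
  proof (rule nn_integral_FTC_Icc)
    fix x assume "x \<in> {K..a}"
    then have "x > 0" using K by auto
    then show "((\<lambda>x. 2 * \<eta> / (2 - p) * x powr (2 - p)) has_real_derivative 2 * \<eta> * x powr (1 - p)) (at x)"
      using p DERIV_cmult[OF has_real_derivative_powr[of x "2 - p"], of "2 * \<eta> / (2 - p)"]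
      by (simp add: mult_ac)
  qed (use K \<open>0 \<le> \<eta>\<close> in auto)
  also have "ennreal (K\<^sup>2) + \<dots> \<le> ennreal (K\<^sup>2) + ennreal (2 * \<eta> / (2 - p) * a powr (2 - p))"
    using p \<open>0 \<le> \<eta>\<close> by (intro add_left_mono ennreal_leI) auto
  also have "\<dots> = ennreal (K\<^sup>2 + 2 * \<eta> / (2 - p) * a powr (2 - p))"
    using p \<open>0 \<le> \<eta>\<close> by (simp add: ennreal_plus)
  finally show ?thesis
    using p \<open>0 \<le> \<eta>\<close> by (subst (asm) ennreal_le_iff) auto
qed

text \<open>
  The error is \<open>|X|\<close> on the event \<open>|X| > a\<close>, hence has mean
  \<open>a P(|X| > a) + \<integral>\<^sub>a\<^sup>\<infinity> P(|X| > x) dx\<close>. The tail bound makes the first term at most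
  \<open>\<eta> a\<^sup>1\<^sup>-\<^sup>p\<close> and the second at most \<open>\<eta> a\<^sup>1\<^sup>-\<^sup>p / (p - 1)\<close>; the integral converges because
  \<open>p > 1\<close>.
\<close>

lemma (in prob_space) truncation_error_le:
  fixes X :: "'a \<Rightarrow> real"
  assumes int: "integrable M X"
    and p: "1 < p" and a: "0 < a" and "0 \<le> \<eta>"
    and tail: "\<And>x. a \<le> x \<Longrightarrow> x powr p * prob {\<omega> \<in> space M. \<bar>X \<omega>\<bar> > x} \<le> \<eta>"
  shows "expectation (\<lambda>\<omega>. \<bar>X \<omega> - truncate_at a (X \<omega>)\<bar>) \<le> p * \<eta> / (p - 1) * a powr (1 - p)"
proof -
  have [measurable]: "X \<in> borel_measurable M"
    using int by auto
  let ?A = "{\<omega> \<in> space M. a < \<bar>X \<omega>\<bar>}"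
  let ?w = "\<lambda>x::real. indicator {a..} x :: ennreal"
  have bound: "c * prob {\<omega> \<in> space M. x < \<bar>X \<omega>\<bar>} \<le> \<eta> * (c * x powr - p)"
    if "a \<le> x" "0 \<le> c" for x c
  proof -
    have "c * prob {\<omega> \<in> space M. x < \<bar>X \<omega>\<bar>}
        = c * x powr - p * (x powr p * prob {\<omega> \<in> space M. x < \<bar>X \<omega>\<bar>})"
      using a that by (simp add: powr_minus)
    also have "\<dots> \<le> c * x powr - p * \<eta>"
      using tail[of x] that by (intro mult_left_mono) auto
    finally show ?thesis by (simp add: mult_ac)
  qed
  have "ennreal (expectation (\<lambda>\<omega>. \<bar>X \<omega> - truncate_at a (X \<omega>)\<bar>))
      = (\<integral>\<^sup>+\<omega>. ennreal \<bar>X \<omega> - truncate_at a (X \<omega>)\<bar> \<partial>M)"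
  proof (rule nn_integral_eq_integral[symmetric])
    show "integrable M (\<lambda>\<omega>. \<bar>X \<omega> - truncate_at a (X \<omega>)\<bar>)"
      using abs_minus_truncate_at_le
      by (intro integrable_abs Bochner_Integration.integrable_bound[OF int]) auto
  qed auto
  also have "\<dots> \<le> (\<integral>\<^sup>+\<omega>. ennreal a * indicator ?A \<omega>
      + (\<integral>\<^sup>+x. ?w x * indicator {..<\<bar>X \<omega>\<bar>} x \<partial>lborel) \<partial>M)"
  proof (rule nn_integral_mono)
    fix \<omega> assume \<omega>: "\<omega> \<in> space M"
    show "ennreal \<bar>X \<omega> - truncate_at a (X \<omega>)\<bar> \<le> ennreal a * indicator ?A \<omega>
        + (\<integral>\<^sup>+x. ?w x * indicator {..<\<bar>X \<omega>\<bar>} x \<partial>lborel)"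
    proof (cases "\<bar>X \<omega>\<bar> \<le> a")
      case False
      have "(\<integral>\<^sup>+x. ?w x * indicator {..<\<bar>X \<omega>\<bar>} x \<partial>lborel)
          = (\<integral>\<^sup>+x. indicator {a..<\<bar>X \<omega>\<bar>} x \<partial>lborel)"
        by (intro nn_integral_cong) (auto simp: indicator_def)
      then show ?thesis
        using False a \<omega> by (simp add: truncate_at_def ennreal_plus[symmetric] del: ennreal_plus)
    qed (simp add: truncate_at_def)
  qed
  also have "\<dots> = ennreal a * emeasure M ?A
      + (\<integral>\<^sup>+\<omega>. (\<integral>\<^sup>+x. ?w x * indicator {..<\<bar>X \<omega>\<bar>} x \<partial>lborel) \<partial>M)"
  proof (subst nn_integral_add)
    have "(\<lambda>\<omega>. \<integral>\<^sup>+x. ?w x * of_bool (x < \<bar>X \<omega>\<bar>) \<partial>lborel) \<in> borel_measurable M"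
      by measurable
    then show "(\<lambda>\<omega>. \<integral>\<^sup>+x. ?w x * indicator {..<\<bar>X \<omega>\<bar>} x \<partial>lborel) \<in> borel_measurable M"
      by (simp add: indicator_def of_bool_def)
  qed (auto simp: nn_integral_cmult_indicator)
  also have "(\<integral>\<^sup>+\<omega>. (\<integral>\<^sup>+x. ?w x * indicator {..<\<bar>X \<omega>\<bar>} x \<partial>lborel) \<partial>M)
      = (\<integral>\<^sup>+x. ?w x * emeasure M {\<omega> \<in> space M. x < \<bar>X \<omega>\<bar>} \<partial>lborel)"
    by (rule nn_integral_layer_cake) auto
  also have "\<dots> \<le> (\<integral>\<^sup>+x. ennreal (\<eta> * x powr - p) * indicator {a..} x \<partial>lborel)"
    using bound[of _ 1]
    by (intro nn_integral_mono) (auto simp: indicator_def emeasure_eq_measure intro!: ennreal_leI)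
  also have "\<dots> = ennreal (0 - \<eta> / (1 - p) * a powr (1 - p))"
  proof (rule nn_integral_FTC_atLeast)
    fix x assume "a \<le> x"
    then have "x > 0" using a by auto
    then show "((\<lambda>x. \<eta> / (1 - p) * x powr (1 - p)) has_real_derivative \<eta> * x powr - p) (at x)"
      using p DERIV_cmult[OF has_real_derivative_powr[of x "1 - p"], of "\<eta> / (1 - p)"] by simp
  next
    have "((\<lambda>x::real. x powr (1 - p)) \<longlongrightarrow> 0) at_top"
      using p by (intro tendsto_neg_powr filterlim_ident) auto
    then show "((\<lambda>x. \<eta> / (1 - p) * x powr (1 - p)) \<longlongrightarrow> 0) at_top"
      by (rule tendsto_mult_right_zero)
  qed (use \<open>0 \<le> \<eta>\<close> in auto)
  also have "ennreal a * emeasure M ?A \<le> ennreal (\<eta> * a powr (1 - p))"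
    using bound[of a a] a
    by (auto simp: emeasure_eq_measure ennreal_mult'[symmetric] powr_diff powr_minus field_simps
        intro!: ennreal_leI)
  finally have "ennreal (expectation (\<lambda>\<omega>. \<bar>X \<omega> - truncate_at a (X \<omega>)\<bar>))
      \<le> ennreal (\<eta> * a powr (1 - p)) + ennreal (0 - \<eta> / (1 - p) * a powr (1 - p))"
    by (simp add: add_right_mono)
  also have "\<dots> = ennreal (\<eta> * a powr (1 - p) + (0 - \<eta> / (1 - p) * a powr (1 - p)))"
    using p \<open>0 \<le> \<eta>\<close>
    by (intro ennreal_plus[symmetric]) (auto intro!: mult_nonpos_nonneg divide_nonneg_nonpos)
  also have "\<eta> * a powr (1 - p) + (0 - \<eta> / (1 - p) * a powr (1 - p)) = p * \<eta> / (p - 1) * a powr (1 - p)"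
    using p by (simp add: divide_simps) (simp add: algebra_simps)
  finally show ?thesis
    using p \<open>0 \<le> \<eta>\<close> by (subst (asm) ennreal_le_iff) auto
qed

section \<open>Little-o rates for the truncated moments\<close>

text \<open>
  Since the tail condition is a limit, \<open>\<eta>\<close> in the bounds above can be taken arbitrarily small
  at the price of a larger threshold. This improves the rates from \<open>O\<close> to \<open>o\<close>.
\<close>

lemma (in prob_space) truncated_second_moment_tendsto_0:
  fixes X :: "'a \<Rightarrow> real"
  assumes X: "X \<in> borel_measurable M"
    and p: "0 < p" "p < 2"
    and tail: "((\<lambda>x. x powr p * prob {\<omega> \<in> space M. \<bar>X \<omega>\<bar> > x}) \<longlongrightarrow> 0) at_top"
  shows "((\<lambda>a. a powr (p - 2) * expectation (\<lambda>\<omega>. (truncate_at a (X \<omega>))\<^sup>2)) \<longlongrightarrow> 0) at_top"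
proof (rule order_tendstoI)
  fix e :: real assume "e < 0"
  then show "\<forall>\<^sub>F a in at_top. e < a powr (p - 2) * expectation (\<lambda>\<omega>. (truncate_at a (X \<omega>))\<^sup>2)"
    by (intro always_eventually allI) (auto intro!: less_le_trans[of e 0] mult_nonneg_nonneg)
next
  fix e :: real assume e: "0 < e"
  \<comment> \<open>The leading coefficient \<open>2 \<eta> / (2 - p)\<close> becomes \<open>e / 2\<close>.\<close>
  define \<eta> where "\<eta> = e * (2 - p) / 4"
  have "\<eta> > 0" using e p by (simp add: \<eta>_def)
  from order_tendstoD(2)[OF tail this] obtain K0 where K0:
    "\<And>x. K0 \<le> x \<Longrightarrow> x powr p * prob {\<omega> \<in> space M. \<bar>X \<omega>\<bar> > x} < \<eta>"
    unfolding eventually_at_top_linorder by blast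
  \<comment> \<open>The bound needs a positive threshold.\<close>
  define K where "K = max K0 1"
  have "((\<lambda>a::real. K\<^sup>2 * a powr (p - 2)) \<longlongrightarrow> 0) at_top"
    using p by (intro tendsto_mult_right_zero tendsto_neg_powr filterlim_ident) auto
  from order_tendstoD(2)[OF this, of "e / 2"] e
  have "\<forall>\<^sub>F a in at_top. K\<^sup>2 * a powr (p - 2) < e / 2"
    by simp
  with eventually_ge_at_top[of K]
  show "\<forall>\<^sub>F a in at_top. a powr (p - 2) * expectation (\<lambda>\<omega>. (truncate_at a (X \<omega>))\<^sup>2) < e"
  proof eventually_elim
    case (elim a)
    have K: "0 < K" "K0 \<le> K" by (auto simp: K_def)
    have "expectation (\<lambda>\<omega>. (truncate_at a (X \<omega>))\<^sup>2) \<le> K\<^sup>2 + 2 * \<eta> / (2 - p) * a powr (2 - p)"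
      using X p K elim \<open>\<eta> > 0\<close> by (intro truncated_second_moment_le less_imp_le[OF K0]) auto
    also have "2 * \<eta> / (2 - p) = e / 2"
      using p by (simp add: \<eta>_def field_simps)
    finally have "a powr (p - 2) * expectation (\<lambda>\<omega>. (truncate_at a (X \<omega>))\<^sup>2)
        \<le> a powr (p - 2) * (K\<^sup>2 + e / 2 * a powr (2 - p))"
      by (intro mult_left_mono) auto
    also have "\<dots> = K\<^sup>2 * a powr (p - 2) + e / 2 * (a powr (p - 2) * a powr (2 - p))"
      by (simp add: algebra_simps)
    also have "a powr (p - 2) * a powr (2 - p) = 1"
      using K elim by (simp add: powr_add[symmetric])
    finally show ?case using elim by simp
  qed
qed

lemma (in prob_space) truncation_error_tendsto_0:
  fixes X :: "'a \<Rightarrow> real"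
  assumes int: "integrable M X" and p: "1 < p"
    and tail: "((\<lambda>x. x powr p * prob {\<omega> \<in> space M. \<bar>X \<omega>\<bar> > x}) \<longlongrightarrow> 0) at_top"
  shows "((\<lambda>a. a powr (p - 1) * expectation (\<lambda>\<omega>. \<bar>X \<omega> - truncate_at a (X \<omega>)\<bar>)) \<longlongrightarrow> 0) at_top"
proof (rule order_tendstoI)
  fix e :: real assume "e < 0"
  then show "\<forall>\<^sub>F a in at_top. e < a powr (p - 1) * expectation (\<lambda>\<omega>. \<bar>X \<omega> - truncate_at a (X \<omega>)\<bar>)"
    by (intro always_eventually allI) (auto intro!: less_le_trans[of e 0] mult_nonneg_nonneg)
next
  fix e :: real assume e: "0 < e"
  \<comment> \<open>The coefficient \<open>p \<eta> / (p - 1)\<close> becomes \<open>e / 2\<close>.\<close>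
  define \<eta> where "\<eta> = e * (p - 1) / (2 * p)"
  have "\<eta> > 0" using e p by (simp add: \<eta>_def)
  from order_tendstoD(2)[OF tail this] obtain K where K:
    "\<And>x. K \<le> x \<Longrightarrow> x powr p * prob {\<omega> \<in> space M. \<bar>X \<omega>\<bar> > x} < \<eta>"
    unfolding eventually_at_top_linorder by blast
  from eventually_ge_at_top[of K] eventually_gt_at_top[of 0]
  show "\<forall>\<^sub>F a in at_top. a powr (p - 1) * expectation (\<lambda>\<omega>. \<bar>X \<omega> - truncate_at a (X \<omega>)\<bar>) < e"
  proof eventually_elim
    case (elim a)
    have "expectation (\<lambda>\<omega>. \<bar>X \<omega> - truncate_at a (X \<omega>)\<bar>) \<le> p * \<eta> / (p - 1) * a powr (1 - p)"
      using int p elim \<open>\<eta> > 0\<close> by (intro truncation_error_le less_imp_le[OF K]) auto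
    also have "p * \<eta> / (p - 1) = e / 2"
      using p by (simp add: \<eta>_def field_simps)
    finally have "a powr (p - 1) * expectation (\<lambda>\<omega>. \<bar>X \<omega> - truncate_at a (X \<omega>)\<bar>)
        \<le> a powr (p - 1) * (e / 2 * a powr (1 - p))"
      by (intro mult_left_mono) auto
    also have "\<dots> = e / 2 * (a powr (p - 1) * a powr (1 - p))"
      by simp
    also have "a powr (p - 1) * a powr (1 - p) = 1"
      using elim by (simp add: powr_add[symmetric])
    finally show ?case using e by simp
  qed
qed

section \<open>First absolute moments of sums of independent variables\<close>

text \<open>
  The cross terms vanish because each summand is centred and independent of the sum of the others.
\<close>

lemma (in prob_space) second_moment_sum_indep:
  fixes Y :: "'i \<Rightarrow> 'a \<Rightarrow> real"
  assumes "finite I" "indep_vars (\<lambda>_. borel) Y I"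
    and "\<And>i. i \<in> I \<Longrightarrow> integrable M (\<lambda>\<omega>. (Y i \<omega>)\<^sup>2)"
    and "\<And>i. i \<in> I \<Longrightarrow> expectation (Y i) = 0"
  shows "integrable M (\<lambda>\<omega>. (\<Sum>i\<in>I. Y i \<omega>)\<^sup>2)" (is ?int)
    and "expectation (\<lambda>\<omega>. (\<Sum>i\<in>I. Y i \<omega>)\<^sup>2) = (\<Sum>i\<in>I. expectation (\<lambda>\<omega>. (Y i \<omega>)\<^sup>2))" (is ?eq)
proof -
  have rv: "Y i \<in> borel_measurable M" if "i \<in> I" for i
    using assms(2) that by (auto simp: indep_vars_def)
  have Yint: "integrable M (Y i)" if "i \<in> I" for i
    using square_integrable_imp_integrable[OF rv[OF that] assms(3)[OF that]] .
  have "?int \<and> ?eq"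
    using assms rv Yint
  proof (induction I rule: finite_induct)
    case (insert i I)
    let ?S = "\<lambda>\<omega>. \<Sum>j\<in>I. Y j \<omega>"
    have IH: "integrable M (\<lambda>\<omega>. (?S \<omega>)\<^sup>2)"
      "expectation (\<lambda>\<omega>. (?S \<omega>)\<^sup>2) = (\<Sum>i\<in>I. expectation (\<lambda>\<omega>. (Y i \<omega>)\<^sup>2))"
      using insert.IH insert.prems indep_vars_subset[OF insert.prems(1), of I] by auto
    have ind: "indep_var borel (Y i) borel ?S"
      using insert by (intro indep_vars_sum) auto
    have S: "integrable M ?S"
      using insert.prems by (intro Bochner_Integration.integrable_sum) auto
    have Yi: "integrable M (Y i)" "integrable M (\<lambda>\<omega>. (Y i \<omega>)\<^sup>2)" "expectation (Y i) = 0"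
      using insert.prems by auto
    have prod: "integrable M (\<lambda>\<omega>. Y i \<omega> * ?S \<omega>)" "expectation (\<lambda>\<omega>. Y i \<omega> * ?S \<omega>) = 0"
      using indep_var_integrable[OF ind Yi(1) S] indep_var_lebesgue_integral[OF ind Yi(1) S] Yi(3)
      by auto
    have expand: "(\<Sum>j\<in>insert i I. Y j \<omega>)\<^sup>2 = (Y i \<omega>)\<^sup>2 + 2 * (Y i \<omega> * ?S \<omega>) + (?S \<omega>)\<^sup>2" for \<omega>
      using insert.hyps by (simp add: power2_sum algebra_simps)
    show ?case
      unfolding expand using Yi prod IH insert.hyps by simp
  qed simp
  then show ?int ?eq by blast+
qed

lemma (in prob_space) expectation_abs_le_sqrt:
  fixes Y :: "'a \<Rightarrow> real"
  assumes "Y \<in> borel_measurable M" "integrable M (\<lambda>\<omega>. (Y \<omega>)\<^sup>2)"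
  shows "expectation (\<lambda>\<omega>. \<bar>Y \<omega>\<bar>) \<le> sqrt (expectation (\<lambda>\<omega>. (Y \<omega>)\<^sup>2))"
proof (rule real_le_rsqrt)
  have "integrable M Y"
    using square_integrable_imp_integrable[OF assms] .
  then have "variance (\<lambda>\<omega>. \<bar>Y \<omega>\<bar>) = expectation (\<lambda>\<omega>. \<bar>Y \<omega>\<bar>\<^sup>2) - (expectation (\<lambda>\<omega>. \<bar>Y \<omega>\<bar>))\<^sup>2"
    using assms by (intro variance_eq) auto
  with variance_positive[of "\<lambda>\<omega>. \<bar>Y \<omega>\<bar>"]
  show "(expectation (\<lambda>\<omega>. \<bar>Y \<omega>\<bar>))\<^sup>2 \<le> expectation (\<lambda>\<omega>. (Y \<omega>)\<^sup>2)"
    by simp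
qed

text \<open>
  Each summand is split into a centred truncated part \<open>u\<close> and a remainder \<open>v\<close>. The sum of the
  \<open>u\<close>-parts is estimated in \<open>L\<^sup>2\<close>, where independence yields the square root of the number of
  terms; the sum of the \<open>v\<close>-parts is estimated by the triangle inequality in \<open>L\<^sup>1\<close>, without any
  cancellation. The factor 2 pays for the centring: as \<open>X\<close> has mean 0, the mean of its truncation
  is, up to sign, the mean of the part cut off. The right-hand side depends on the index set only
  through its cardinality, so it is the same for all windows of the same length.
\<close>

lemma (in prob_space) expectation_abs_sum_iid_le:
  fixes Y :: "'i \<Rightarrow> 'a \<Rightarrow> real" and X :: "'a \<Rightarrow> real"
  assumes "finite I" and indep: "indep_vars (\<lambda>_. borel) Y I"
    and ident: "\<And>i. i \<in> I \<Longrightarrow> distr M borel (Y i) = distr M borel X"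
    and int: "integrable M X" and mean: "expectation X = 0" and a: "0 \<le> a"
  shows "integrable M (\<lambda>\<omega>. \<Sum>i\<in>I. Y i \<omega>)"
    and "expectation (\<lambda>\<omega>. \<bar>\<Sum>i\<in>I. Y i \<omega>\<bar>)
      \<le> sqrt (card I * expectation (\<lambda>\<omega>. (truncate_at a (X \<omega>))\<^sup>2))
        + 2 * card I * expectation (\<lambda>\<omega>. \<bar>X \<omega> - truncate_at a (X \<omega>)\<bar>)"
proof -
  have [measurable]: "X \<in> borel_measurable M"
    using int by auto
  have rv [measurable]: "Y i \<in> borel_measurable M" if "i \<in> I" for i
    using indep that by (auto simp: indep_vars_def)
  \<comment> \<open>Equality in law moves every moment of a \<open>Y i\<close> to \<open>X\<close>.\<close>
  have transport: "expectation (\<lambda>\<omega>. g (Y i \<omega>)) = expectation (\<lambda>\<omega>. g (X \<omega>))"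
    "integrable M (\<lambda>\<omega>. g (Y i \<omega>)) \<longleftrightarrow> integrable M (\<lambda>\<omega>. g (X \<omega>))"
    if "i \<in> I" and [measurable]: "g \<in> borel_measurable borel" for i and g :: "real \<Rightarrow> real"
    using integral_distr[OF rv[OF \<open>i \<in> I\<close>], of g] integral_distr[of X M borel g]
      integrable_distr_eq[OF rv[OF \<open>i \<in> I\<close>], of g] integrable_distr_eq[of X M borel g]
      ident[OF \<open>i \<in> I\<close>]
    by simp_all
  have trunc_int: "integrable M (\<lambda>\<omega>. truncate_at a (X \<omega>))"
    using abs_truncate_at_le by (intro Bochner_Integration.integrable_bound[OF int]) auto
  have trunc_sq_int: "integrable M (\<lambda>\<omega>. (truncate_at a (X \<omega>))\<^sup>2)"
    using a by (intro integrable_truncate_at_square) auto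
  define V where "V = expectation (\<lambda>\<omega>. (truncate_at a (X \<omega>))\<^sup>2)"
  define T where "T = expectation (\<lambda>\<omega>. \<bar>X \<omega> - truncate_at a (X \<omega>)\<bar>)"
  define m where "m = expectation (\<lambda>\<omega>. truncate_at a (X \<omega>))"
  have m_le: "\<bar>m\<bar> \<le> T"
  proof -
    have "m = - expectation (\<lambda>\<omega>. X \<omega> - truncate_at a (X \<omega>))"
      using int trunc_int mean by (simp add: m_def)
    then have "\<bar>m\<bar> = \<bar>expectation (\<lambda>\<omega>. X \<omega> - truncate_at a (X \<omega>))\<bar>"
      by simp
    also have "\<dots> \<le> T"
      unfolding T_def by (rule integral_abs_bound)
    finally show ?thesis .
  qed
  let ?u = "\<lambda>x. truncate_at a x - m" and ?v = "\<lambda>x. x - truncate_at a x + m"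
  have u_sq: "integrable M (\<lambda>\<omega>. (?u (X \<omega>))\<^sup>2)"
    unfolding power2_diff using trunc_int trunc_sq_int by simp
  have u_var: "expectation (\<lambda>\<omega>. (?u (X \<omega>))\<^sup>2) \<le> V"
    using variance_eq[OF trunc_int trunc_sq_int] by (simp add: m_def V_def)
  have v_int: "integrable M (\<lambda>\<omega>. ?v (X \<omega>))"
    using int trunc_int by simp
  have v_le: "expectation (\<lambda>\<omega>. \<bar>?v (X \<omega>)\<bar>) \<le> 2 * T"
  proof -
    have "expectation (\<lambda>\<omega>. \<bar>?v (X \<omega>)\<bar>)
        \<le> expectation (\<lambda>\<omega>. \<bar>X \<omega> - truncate_at a (X \<omega>)\<bar> + \<bar>m\<bar>)"
      using int trunc_int by (intro integral_mono) auto
    also have "\<dots> = T + \<bar>m\<bar>"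
      using int trunc_int by (simp add: T_def prob_space)
    finally show ?thesis using m_le by simp
  qed
  let ?U = "\<lambda>\<omega>. \<Sum>i\<in>I. ?u (Y i \<omega>)" and ?V = "\<lambda>\<omega>. \<Sum>i\<in>I. ?v (Y i \<omega>)"
  have u_indep: "indep_vars (\<lambda>_. borel) (\<lambda>i \<omega>. ?u (Y i \<omega>)) I"
    by (rule indep_vars_compose2[OF indep]) measurable
  have u_mean: "expectation (\<lambda>\<omega>. ?u (Y i \<omega>)) = 0" if "i \<in> I" for i
    using transport(1)[OF that, of ?u] trunc_int by (simp add: m_def prob_space)
  have u_sq': "integrable M (\<lambda>\<omega>. (?u (Y i \<omega>))\<^sup>2)" if "i \<in> I" for i
    using transport(2)[OF that, of "\<lambda>x. (?u x)\<^sup>2"] u_sq by simp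
  note U = second_moment_sum_indep[OF \<open>finite I\<close> u_indep u_sq' u_mean]
  have U_meas: "?U \<in> borel_measurable M"
    by measurable
  have U_int: "integrable M ?U"
    using square_integrable_imp_integrable[OF U_meas U(1)] .
  have "expectation (\<lambda>\<omega>. (?U \<omega>)\<^sup>2) = (\<Sum>i\<in>I. expectation (\<lambda>\<omega>. (?u (Y i \<omega>))\<^sup>2))"
    by (rule U(2))
  also have "\<dots> = (\<Sum>i\<in>I. expectation (\<lambda>\<omega>. (?u (X \<omega>))\<^sup>2))"
    by (intro sum.cong refl transport(1)[of _ "\<lambda>x. (?u x)\<^sup>2"]) measurable
  also have "\<dots> \<le> card I * V"
    using u_var by (simp add: mult_left_mono)
  finally have U_le: "expectation (\<lambda>\<omega>. \<bar>?U \<omega>\<bar>) \<le> sqrt (card I * V)"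
    using expectation_abs_le_sqrt[OF U_meas U(1)] by (meson order_trans real_sqrt_le_mono)
  have v_int': "integrable M (\<lambda>\<omega>. ?v (Y i \<omega>))" if "i \<in> I" for i
    using transport(2)[OF that, of ?v] v_int by simp
  then have V_int: "integrable M ?V"
    by (intro Bochner_Integration.integrable_sum)
  have "expectation (\<lambda>\<omega>. \<bar>?V \<omega>\<bar>) \<le> expectation (\<lambda>\<omega>. \<Sum>i\<in>I. \<bar>?v (Y i \<omega>)\<bar>)"
    using V_int v_int' by (intro integral_mono sum_abs Bochner_Integration.integrable_sum integrable_abs)
  also have "\<dots> = (\<Sum>i\<in>I. expectation (\<lambda>\<omega>. \<bar>?v (Y i \<omega>)\<bar>))"
    using v_int' by (intro Bochner_Integration.integral_sum integrable_abs)
  also have "\<dots> = (\<Sum>i\<in>I. expectation (\<lambda>\<omega>. \<bar>?v (X \<omega>)\<bar>))"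
    by (intro sum.cong refl transport(1)[of _ "\<lambda>x. \<bar>?v x\<bar>"]) measurable
  also have "\<dots> \<le> card I * (2 * T)"
    using v_le by (simp add: mult_left_mono)
  finally have V_le: "expectation (\<lambda>\<omega>. \<bar>?V \<omega>\<bar>) \<le> card I * (2 * T)" .
  have split: "(\<Sum>i\<in>I. Y i \<omega>) = ?U \<omega> + ?V \<omega>" for \<omega>
    by (simp add: sum.distrib[symmetric])
  show "integrable M (\<lambda>\<omega>. \<Sum>i\<in>I. Y i \<omega>)"
    unfolding split using U_int V_int by (rule Bochner_Integration.integrable_add)
  have "expectation (\<lambda>\<omega>. \<bar>\<Sum>i\<in>I. Y i \<omega>\<bar>) \<le> expectation (\<lambda>\<omega>. \<bar>?U \<omega>\<bar> + \<bar>?V \<omega>\<bar>)"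
    unfolding split using U_int V_int
    by (intro integral_mono integrable_abs Bochner_Integration.integrable_add) auto
  also have "\<dots> = expectation (\<lambda>\<omega>. \<bar>?U \<omega>\<bar>) + expectation (\<lambda>\<omega>. \<bar>?V \<omega>\<bar>)"
    using U_int V_int by (intro Bochner_Integration.integral_add integrable_abs)
  also have "\<dots> \<le> sqrt (card I * V) + 2 * card I * T"
    using U_le V_le by simp
  finally show "expectation (\<lambda>\<omega>. \<bar>\<Sum>i\<in>I. Y i \<omega>\<bar>)
      \<le> sqrt (card I * expectation (\<lambda>\<omega>. (truncate_at a (X \<omega>))\<^sup>2))
        + 2 * card I * expectation (\<lambda>\<omega>. \<bar>X \<omega> - truncate_at a (X \<omega>)\<bar>)"
    unfolding V_def T_def .
qed

section \<open>The linear process\<close>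

text \<open>
  Working in \<^typ>\<open>ennreal\<close> makes the triangle inequality for series available without absolute
  convergence: if that fails, the right-hand side is infinite.
\<close>

lemma abs_le_suminf_abs:
  fixes f :: "nat \<Rightarrow> real"
  assumes "f sums s"
  shows "ennreal \<bar>s\<bar> \<le> (\<Sum>j. ennreal \<bar>f j\<bar>)"
proof (cases "(\<Sum>j. ennreal \<bar>f j\<bar>) = top")
  case False
  then have sm: "summable (\<lambda>j. \<bar>f j\<bar>)"
    by (intro summable_suminf_not_top) auto
  have "\<bar>s\<bar> \<le> (\<Sum>j. \<bar>f j\<bar>)"
    using summable_rabs[OF sm] assms by (simp add: sums_iff)
  then show ?thesis
    using sm by (subst suminf_ennreal2) (auto intro: ennreal_leI)
qed simp

text \<open>
  Interchanging the finite sum over \<open>k\<close> with the series over \<open>j\<close> writes the partial sum as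
  \<open>\<Sum>\<^sub>j \<psi>\<^sub>j W\<^sub>j\<close>, where \<open>W\<^sub>j\<close> is the sum of the innovations over the window \<open>{1 - j..n - j}\<close>.
  The \<open>W\<^sub>j\<close> are strongly dependent, but the \<open>L\<^sup>1\<close> triangle inequality only asks for a bound on
  their individual first moments.
\<close>

lemma (in prob_space) nn_integral_linear_process_sum_le:
  fixes \<epsilon> :: "int \<Rightarrow> 'a \<Rightarrow> real"
  assumes meas [measurable]: "\<And>k. \<epsilon> k \<in> borel_measurable M"
    and ident: "\<And>k. distr M borel (\<epsilon> k) = distr M borel (\<epsilon> 0)"
    and int: "integrable M (\<epsilon> 0)"
    and psi: "summable (\<lambda>j::nat. \<bar>\<psi> (int j)\<bar>)"
    and windows: "\<And>j. (\<integral>\<^sup>+\<omega>. ennreal \<bar>\<Sum>k=1..n. \<epsilon> (int k - int j) \<omega>\<bar> \<partial>M) \<le> ennreal c"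
  shows "(\<integral>\<^sup>+\<omega>. ennreal \<bar>linear_process_sum \<psi> \<epsilon> n \<omega>\<bar> \<partial>M)
      \<le> ennreal (\<Sum>j. \<bar>\<psi> (int j)\<bar>) * ennreal c"
proof -
  let ?W = "\<lambda>j \<omega>. \<Sum>k=1..n. \<epsilon> (int k - int j) \<omega>"
  have "AE \<omega> in M. \<forall>k. (\<lambda>j. \<psi> (int j) * \<epsilon> (k - int j) \<omega>) sums linear_process \<psi> \<epsilon> k \<omega>"
    unfolding AE_all_countable by (intro allI linear_process_AE_sums) fact+
  then have "AE \<omega> in M. ennreal \<bar>linear_process_sum \<psi> \<epsilon> n \<omega>\<bar> \<le> (\<Sum>j. ennreal \<bar>\<psi> (int j) * ?W j \<omega>\<bar>)"
  proof eventually_elim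
    case (elim \<omega>)
    then have "(\<lambda>j. \<Sum>k=1..n. \<psi> (int j) * \<epsilon> (int k - int j) \<omega>) sums linear_process_sum \<psi> \<epsilon> n \<omega>"
      unfolding linear_process_sum_def by (intro sums_sum) auto
    then show ?case
      by (intro abs_le_suminf_abs) (simp add: sum_distrib_left)
  qed
  then have "(\<integral>\<^sup>+\<omega>. ennreal \<bar>linear_process_sum \<psi> \<epsilon> n \<omega>\<bar> \<partial>M)
      \<le> (\<integral>\<^sup>+\<omega>. (\<Sum>j. ennreal \<bar>\<psi> (int j) * ?W j \<omega>\<bar>) \<partial>M)"
    by (rule nn_integral_mono_AE)
  also have "\<dots> = (\<Sum>j. \<integral>\<^sup>+\<omega>. ennreal \<bar>\<psi> (int j) * ?W j \<omega>\<bar> \<partial>M)"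
    by (rule nn_integral_suminf) measurable
  also have "\<dots> = (\<Sum>j. ennreal \<bar>\<psi> (int j)\<bar> * (\<integral>\<^sup>+\<omega>. ennreal \<bar>?W j \<omega>\<bar> \<partial>M))"
    by (simp add: abs_mult ennreal_mult nn_integral_cmult)
  also have "\<dots> \<le> (\<Sum>j. ennreal \<bar>\<psi> (int j)\<bar> * ennreal c)"
    using windows by (intro suminf_le mult_left_mono) auto
  also have "\<dots> = ennreal (\<Sum>j. \<bar>\<psi> (int j)\<bar>) * ennreal c"
    using psi by (simp add: suminf_ennreal2)
  finally show ?thesis .
qed

lemma (in prob_space) tendsto_in_probability_0_of_L1:
  fixes Y :: "nat \<Rightarrow> 'a \<Rightarrow> real"
  assumes meas: "\<And>n. Y n \<in> borel_measurable M"
    and bound: "\<And>n. (\<integral>\<^sup>+\<omega>. ennreal \<bar>Y n \<omega>\<bar> \<partial>M) \<le> ennreal (b n)"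
    and b: "\<And>n. 0 \<le> b n" "b \<longlonglongrightarrow> 0"
  shows "tendsto_in_probability M Y (\<lambda>_. 0)"
  unfolding tendsto_in_probability_def
proof (intro conjI allI impI)
  note [measurable] = meas
  fix \<delta> :: real assume \<delta>: "\<delta> > 0"
  have markov: "prob {\<omega> \<in> space M. \<bar>Y n \<omega> - 0\<bar> > \<delta>} \<le> b n / \<delta>" for n
  proof -
    have "ennreal \<delta> * emeasure M {\<omega> \<in> space M. \<bar>Y n \<omega> - 0\<bar> > \<delta>}
        = (\<integral>\<^sup>+\<omega>. ennreal \<delta> * indicator {\<omega> \<in> space M. \<bar>Y n \<omega> - 0\<bar> > \<delta>} \<omega> \<partial>M)"
      by (subst nn_integral_cmult_indicator) auto
    also have "\<dots> \<le> (\<integral>\<^sup>+\<omega>. ennreal \<bar>Y n \<omega>\<bar> \<partial>M)"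
      by (intro nn_integral_mono) (auto simp: indicator_def intro!: ennreal_leI)
    also note bound[of n]
    finally have "\<delta> * prob {\<omega> \<in> space M. \<bar>Y n \<omega> - 0\<bar> > \<delta>} \<le> b n"
      using \<delta> b(1)[of n] by (simp add: emeasure_eq_measure ennreal_mult'[symmetric])
    then show ?thesis using \<delta> by (simp add: field_simps)
  qed
  have "(\<lambda>n. b n / \<delta>) \<longlonglongrightarrow> 0"
    using tendsto_divide[OF b(2) tendsto_const[of \<delta>]] \<delta> by simp
  then show "(\<lambda>n. prob {\<omega> \<in> space M. \<bar>Y n \<omega> - 0\<bar> > \<delta>}) \<longlonglongrightarrow> 0"
    by (rule tendsto_sandwich[OF _ _ tendsto_const, rotated 2])
      (use markov in \<open>auto intro!: always_eventually\<close>)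
qed (use meas in auto)

text \<open>
  With \<open>a\<^sub>n = n\<^sup>1\<^sup>/\<^sup>p\<close> as truncation level, dividing the window bound by \<open>a\<^sub>n\<close> and using
  \<open>n = a\<^sub>n\<^sup>p\<close> gives \<open>sqrt (a\<^sub>n\<^sup>p\<^sup>-\<^sup>2 V(a\<^sub>n)) + 2 a\<^sub>n\<^sup>p\<^sup>-\<^sup>1 T(a\<^sub>n)\<close>, exactly the normalizations in
  which the two truncated moments tend to 0.
\<close>

theorem proposition1:
  fixes M :: "'a measure" and \<epsilon> :: "int \<Rightarrow> 'a \<Rightarrow> real" and \<psi> :: "int \<Rightarrow> real" and p :: real
  assumes "prob_space M"
    and "1 < p" and "p < 2"
    and "prob_space.indep_vars M (\<lambda>_. borel) \<epsilon> UNIV"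
    and "\<And>k. distr M borel (\<epsilon> k) = distr M borel (\<epsilon> 0)"
    and "((\<lambda>x::real. x powr p * measure M {\<omega> \<in> space M. \<bar>\<epsilon> 0 \<omega>\<bar> > x}) \<longlongrightarrow> 0) at_top"
    and "integrable M (\<epsilon> 0)" and "(\<integral>\<omega>. \<epsilon> 0 \<omega> \<partial>M) = 0"
    and "\<And>j. j < 0 \<Longrightarrow> \<psi> j = 0"
    and "summable (\<lambda>j::nat. \<bar>\<psi> (int j)\<bar>)"
  shows "tendsto_in_probability M
           (\<lambda>n \<omega>. linear_process_sum \<psi> \<epsilon> n \<omega> / real n powr (1 / p)) (\<lambda>_. 0)"
proof -
  interpret prob_space M by fact
  have meas [measurable]: "\<epsilon> k \<in> borel_measurable M" for k
    using assms(4) by (auto simp: indep_vars_def)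
  define a where "a n = real n powr (1 / p)" for n
  define V where "V x = expectation (\<lambda>\<omega>. (truncate_at x (\<epsilon> 0 \<omega>))\<^sup>2)" for x
  define T where "T x = expectation (\<lambda>\<omega>. \<bar>\<epsilon> 0 \<omega> - truncate_at x (\<epsilon> 0 \<omega>)\<bar>)" for x
  define \<Psi> where "\<Psi> = (\<Sum>j. \<bar>\<psi> (int j)\<bar>)"
  define c where "c n = sqrt (real n * V (a n)) + 2 * real n * T (a n)" for n
  have nonneg: "0 \<le> a n" "0 \<le> V x" "0 \<le> T x" "0 \<le> \<Psi>" "0 \<le> c n" for n x
    using assms(10) by (auto simp: a_def V_def T_def \<Psi>_def c_def intro!: suminf_nonneg)
  \<comment> \<open>Each window consists of \<open>n\<close> distinct innovations, so the bound \<open>c n\<close> is uniform in \<open>j\<close>.\<close>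
  have windows: "(\<integral>\<^sup>+\<omega>. ennreal \<bar>\<Sum>k=1..n. \<epsilon> (int k - int j) \<omega>\<bar> \<partial>M) \<le> ennreal (c n)" for n j
  proof -
    let ?I = "(\<lambda>k. int k - int j) ` {1..n}"
    have inj: "inj_on (\<lambda>k. int k - int j) {1..n}"
      by (auto simp: inj_on_def)
    have indep: "indep_vars (\<lambda>_. borel) \<epsilon> ?I"
      by (rule indep_vars_subset[OF assms(4)]) auto
    have "(\<integral>\<^sup>+\<omega>. ennreal \<bar>\<Sum>k=1..n. \<epsilon> (int k - int j) \<omega>\<bar> \<partial>M) = (\<integral>\<^sup>+\<omega>. ennreal \<bar>\<Sum>i\<in>?I. \<epsilon> i \<omega>\<bar> \<partial>M)"
      unfolding sum.reindex[OF inj] by (simp add: comp_def)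
    also have "\<dots> = ennreal (expectation (\<lambda>\<omega>. \<bar>\<Sum>i\<in>?I. \<epsilon> i \<omega>\<bar>))"
      using expectation_abs_sum_iid_le(1)[OF _ indep assms(5) assms(7,8) nonneg(1)]
      by (intro nn_integral_eq_integral integrable_abs) auto
    also have "\<dots> \<le> ennreal (c n)"
      using expectation_abs_sum_iid_le(2)[OF _ indep assms(5) assms(7,8) nonneg(1)[of n]] card_image[OF inj]
      by (intro ennreal_leI) (auto simp: c_def V_def T_def)
    finally show ?thesis .
  qed
  have a_lim: "filterlim a at_top sequentially"
    unfolding a_def using assms(2) by real_asymp
  have V_lim: "(\<lambda>n. a n powr (p - 2) * V (a n)) \<longlonglongrightarrow> 0"
    unfolding V_def using assms
    by (intro filterlim_compose[OF truncated_second_moment_tendsto_0 a_lim]) auto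
  have T_lim: "(\<lambda>n. a n powr (p - 1) * T (a n)) \<longlonglongrightarrow> 0"
    unfolding T_def using assms
    by (intro filterlim_compose[OF truncation_error_tendsto_0 a_lim]) auto
  have "(\<lambda>n. sqrt (a n powr (p - 2) * V (a n)) + 2 * (a n powr (p - 1) * T (a n))) \<longlonglongrightarrow> sqrt 0 + 2 * 0"
    by (intro tendsto_intros V_lim T_lim)
  also have "(\<lambda>n. sqrt (a n powr (p - 2) * V (a n)) + 2 * (a n powr (p - 1) * T (a n))) = (\<lambda>n. c n / a n)"
  proof
    fix n
    show "sqrt (a n powr (p - 2) * V (a n)) + 2 * (a n powr (p - 1) * T (a n)) = c n / a n"
    \<comment> \<open>For \<open>n = 0\<close> both sides are 0, since \<open>0 powr x = 0\<close> and division by 0 gives 0.\<close>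
    proof (cases "n = 0")
      case False
      then have pos: "a n > 0" by (simp add: a_def)
      have n: "real n = a n powr p"
        using False assms(2) by (simp add: a_def powr_powr)
      have "a n powr (p - 2) = real n / (a n)\<^sup>2" "a n powr (p - 1) = real n / a n"
        using pos by (simp_all add: n powr_diff)
      then show ?thesis
        using pos by (simp add: c_def real_sqrt_divide real_sqrt_mult add_divide_distrib)
    qed (simp add: a_def c_def)
  qed
  finally have "(\<lambda>n. \<Psi> * (c n / a n)) \<longlonglongrightarrow> 0"
    by (intro tendsto_mult_right_zero) simp
  moreover have "(\<integral>\<^sup>+\<omega>. ennreal \<bar>linear_process_sum \<psi> \<epsilon> n \<omega> / a n\<bar> \<partial>M) \<le> ennreal (\<Psi> * (c n / a n))" for n
  proof -
    have meas_sum [measurable]: "linear_process_sum \<psi> \<epsilon> n \<in> borel_measurable M"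
      unfolding linear_process_sum_def[abs_def]
      using linear_process_measurable[OF meas] by measurable
    have "(\<integral>\<^sup>+\<omega>. ennreal \<bar>linear_process_sum \<psi> \<epsilon> n \<omega> / a n\<bar> \<partial>M)
        = (\<integral>\<^sup>+\<omega>. ennreal (1 / a n) * ennreal \<bar>linear_process_sum \<psi> \<epsilon> n \<omega>\<bar> \<partial>M)"
      using nonneg(1)[of n] by (simp add: ennreal_mult'[symmetric] abs_divide)
    also have "\<dots> = ennreal (1 / a n) * (\<integral>\<^sup>+\<omega>. ennreal \<bar>linear_process_sum \<psi> \<epsilon> n \<omega>\<bar> \<partial>M)"
      by (rule nn_integral_cmult) measurable
    also have "\<dots> \<le> ennreal (1 / a n) * (ennreal \<Psi> * ennreal (c n))"
      unfolding \<Psi>_def using assms(5,7,10) windows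
      by (intro mult_left_mono nn_integral_linear_process_sum_le) auto
    also have "\<dots> = ennreal (\<Psi> * (c n / a n))"
      using nonneg by (simp add: ennreal_mult'[symmetric])
    finally show ?thesis .
  qed
  moreover have "(\<lambda>\<omega>. linear_process_sum \<psi> \<epsilon> n \<omega> / a n) \<in> borel_measurable M" for n
    unfolding linear_process_sum_def using linear_process_measurable[OF meas] by measurable
  ultimately show ?thesis
    using nonneg unfolding a_def[symmetric] by (intro tendsto_in_probability_0_of_L1) auto
qed

end
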